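(* Let $n,m\ge 1$ be integers and let $p\in\{2,\infty\}$. Let $f: B_{\ell_p^n}\times\mathbb{D}^m\to\mathbb{D}^m$ be holomorphic, let $\phi$ be an automorphism of $\mathbb{D}^m$, and suppose that there exists $z_0\in B_{\ell_p^n}$ such that $f(z_0,w)=\phi(w)$ for all $w\in\mathbb{D}^m$. Then $f(z,w)=\phi(w)$ for all $(z,w)\in B_{\ell_p^n}\times\mathbb{D}^m$.
   Context: $\mathbb{D}=\{z\in\mathbb{C}:|z|<1\}$ is the open unit disk and $\mathbb{D}^m=\{w\in\mathbb{C}^m:\max_{1\le j\le m}|w_j|<1\}$ is the unit polydisk. $B_{\ell_2^n}=\{z\in\mathbb{C}^n:(|z_1|^2+\cdots+|z_n|^2)^{1/2}<1\}$ is the open Euclidean unit ball, and $B_{\ell_\infty^n}=\mathbb{D}^n$. An automorphism of $\mathbb{D}^m$ is a biholomorphic map of $\mathbb{D}^m$ onto itself. *)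

theory Defs
  imports "HOL-Analysis.Analysis"
begin

text \<open>
  Holomorphy between finite-dimensional complex vector spaces is real Frechet
  differentiability with a complex-linear derivative.  The library's \<open>holomorphic_on\<close>
  only covers functions of one complex variable, and the types \<^typ>\<open>complex ^ 'n\<close> and
  \<^typ>\<open>(complex ^ 'n) \<times> (complex ^ 'm)\<close> are only real normed spaces in the library, so the
  complex scalar multiplications of domain and codomain are explicit parameters.
  Intended for open \<^term>\<open>S\<close>.
\<close>

definition holomorphic_map_on ::
  "(complex \<Rightarrow> 'a \<Rightarrow> 'a) \<Rightarrow> (complex \<Rightarrow> 'b \<Rightarrow> 'b) \<Rightarrow> ('a::real_normed_vector \<Rightarrow> 'b::real_normed_vector) \<Rightarrow> 'a set \<Rightarrow> bool"
  where
  "holomorphic_map_on scaleA scaleB f S \<longleftrightarrow>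
     (\<forall>x\<in>S. \<exists>f'. (f has_derivative f') (at x) \<and> Vector_Spaces.linear scaleA scaleB f')"

definition prod_scale ::
  "complex \<Rightarrow> (complex ^ 'n) \<times> (complex ^ 'm) \<Rightarrow> (complex ^ 'n) \<times> (complex ^ 'm)" where
  "prod_scale c x = (c *s fst x, c *s snd x)"

definition biholomorphic_map ::
  "(complex ^ 'm \<Rightarrow> complex ^ 'm) \<Rightarrow> (complex ^ 'm::finite) set \<Rightarrow> (complex ^ 'm) set \<Rightarrow> bool" where
  "biholomorphic_map \<phi> U V \<longleftrightarrow>
     holomorphic_map_on (*s) (*s) \<phi> U \<and> bij_betw \<phi> U V \<and>
     holomorphic_map_on (*s) (*s) (inv_into U \<phi>) V"

text \<open>The library's \<^const>\<open>infnorm\<close> on \<^typ>\<open>complex ^ 'n\<close> takes real and imaginary parts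
  separately, so it is not the complex sup norm; hence the explicit maximum of moduli.\<close>

definition lp_norm :: "ereal \<Rightarrow> complex ^ ('n::finite) \<Rightarrow> real" where
  "lp_norm p z =
     (if p = \<infinity> then Max (range (\<lambda>j. cmod (z $ j)))
      else (\<Sum>j\<in>UNIV. cmod (z $ j) powr real_of_ereal p) powr (1 / real_of_ereal p))"

definition lp_ball :: "ereal \<Rightarrow> (complex ^ ('n::finite)) set" where
  "lp_ball p = {z. lp_norm p z < 1}"

definition polydisk :: "(complex ^ ('m::finite)) set" where
  "polydisk = {w. Max (range (\<lambda>j. cmod (w $ j))) < 1}"

definition polydisk_automorphism :: "(complex ^ ('m::finite) \<Rightarrow> complex ^ 'm) \<Rightarrow> bool" where
  "polydisk_automorphism \<phi> \<longleftrightarrow> biholomorphic_map \<phi> polydisk polydisk"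

lemma prod_scale_vector_space:
  "vector_space (prod_scale :: complex \<Rightarrow> (complex ^ 'n) \<times> (complex ^ 'm) \<Rightarrow> _)"
  by unfold_locales (auto simp: prod_scale_def vec.scale_right_distrib vec.scale_left_distrib)

lemma lp_norm_2: "lp_norm 2 z = norm z"
proof -
  have "real_of_ereal 2 = 2"
    by (metis numeral_eq_ereal real_of_ereal.simps(1))
  moreover have "(\<Sum>j\<in>UNIV. (cmod (z $ j))\<^sup>2) \<ge> 0"
    by (simp add: sum_nonneg)
  moreover have "(2::ereal) \<noteq> \<infinity>"
    by simp
  ultimately show ?thesis
    by (simp add: lp_norm_def norm_vec_def L2_set_def powr_half_sqrt)
qed

lemma lp_ball_2: "lp_ball 2 = ball 0 1"
  unfolding lp_ball_def lp_norm_2 by (simp add: ball_def)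

lemma lp_ball_infinity: "lp_ball \<infinity> = polydisk"
  by (simp add: lp_ball_def lp_norm_def polydisk_def)

lemma polydisk_iff: "w \<in> polydisk \<longleftrightarrow> (\<forall>j. cmod (w $ j) < 1)"
  by (auto simp: polydisk_def)

lemma open_polydisk: "open (polydisk :: (complex ^ ('m::finite)) set)"
proof -
  have "polydisk = (\<Inter>j. {w :: complex ^ 'm. cmod (w $ j) < 1})"
    by (auto simp: polydisk_iff)
  moreover have "open \<dots>"
    by (intro open_INT ballI open_Collect_less continuous_intros) auto
  ultimately show ?thesis
    by simp
qed

end

theory Submission
  imports Defs "HOL-Complex_Analysis.Complex_Analysis"
begin

text \<open>
  Composing \<open>f\<close> with \<open>\<phi>\<inverse>\<close> reduces the claim to maps \<open>g\<close> into the polydisk with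
  \<open>g (z0, w) = w\<close>, and such a \<open>g\<close> can be studied one coordinate and one complex line at a
  time.  To compare \<open>g (z, w)\<close> with \<open>w\<close> in coordinate \<open>j\<close>, let the first argument run over the complex
  line through \<open>z0\<close> and \<open>z\<close>, with parameter \<open>u\<close>, and replace the \<open>j\<close>-th entry of \<open>w\<close> by a
  variable \<open>\<zeta>\<close> of the unit disk.  The \<open>j\<close>-th coordinate of \<open>g\<close> becomes a family \<open>h u \<zeta>\<close> of maps
  of the unit disk into itself, holomorphic in each variable, with \<open>h 0\<close> the identity.

  Such a family is constant in \<open>u\<close>, for the following reason
  (\<open>disk_family_through_identity\<close>).  By the Schwarz-Pick lemma in \<open>u\<close>, for \<open>u\<close> in a disk about
  \<open>0\<close> the hyperbolic distance from \<open>h u \<zeta>\<close> to \<open>\<zeta>\<close> is bounded independently of \<open>\<zeta>\<close>.  A hyperbolic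
  ball of fixed radius has Euclidean size comparable to the distance of its centre from the unit
  circle, so \<open>h u \<zeta> - \<zeta>\<close> tends to \<open>0\<close> as \<open>\<zeta>\<close> approaches the circle
  (\<open>Schwarz_Pick_displacement\<close>).  The maximum principle in \<open>\<zeta>\<close> then forces \<open>h u \<zeta> = \<zeta>\<close>
  (\<open>holomorphic_zero_if_boundary_bound\<close>), and the identity theorem in \<open>u\<close> extends this
  from the small disk to every parameter whose point on the line lies in the ball.

  The identity theorem applies because the \<open>\<ell>\<^sub>p\<close> ball is open and convex, which makes the
  set of these parameters open and connected.
\<close>

text \<open>
  The Schwarz-Pick lemma bounds the pseudohyperbolic distance from \<open>k u\<close> to \<open>k 0\<close> by
  \<open>r = norm u / R\<close>.  The statement is its Euclidean consequence, with the factor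
  \<open>1 - (norm (k 0))\<^sup>2\<close> that makes the displacement vanish as \<open>k 0\<close> approaches the unit circle.
\<close>

lemma Schwarz_Pick_displacement:
  assumes hol: "k holomorphic_on ball 0 R"
    and lt1: "\<And>u. u \<in> ball 0 R \<Longrightarrow> norm (k u) < 1"
    and u: "u \<in> ball 0 R"
  shows "(R - norm u) * norm (k u - k 0) \<le> norm u * (1 - (norm (k 0))\<^sup>2)"
proof -
  define a where "a = k 0"
  have R: "R > 0"
    using u by (auto intro: le_less_trans[OF norm_ge_zero])
  have a: "norm a < 1"
    using lt1[of 0] R by (simp add: a_def)
  define q where "q = (\<lambda>v. Moebius_function 0 a (k (of_real R * v)))"
  have mem: "of_real R * v \<in> ball 0 R" if "v \<in> ball 0 1" for v :: complex
    using that R by (simp add: norm_mult)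
  have "(k \<circ> (\<lambda>v. of_real R * v)) holomorphic_on ball 0 1"
    by (rule holomorphic_on_compose_gen[OF _ hol]) (use mem in \<open>auto intro!: holomorphic_intros\<close>)
  then have "(Moebius_function 0 a \<circ> (k \<circ> (\<lambda>v. of_real R * v))) holomorphic_on ball 0 1"
    by (rule holomorphic_on_compose_gen[OF _ Moebius_function_holomorphic[OF a]])
      (use mem lt1 in auto)
  then have q_hol: "q holomorphic_on ball 0 1"
    by (simp add: q_def o_def)
  have q0: "q 0 = 0"
    by (simp add: q_def a_def Moebius_function_def)
  have q_lt: "norm (q v) < 1" if "norm v < 1" for v
    unfolding q_def using that mem[of v] by (intro Moebius_function_norm_lt_1 a lt1) auto
  define r where "r = norm u / R"
  have r: "norm (u / of_real R) = r" "r < 1"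
    using R u by (auto simp: r_def norm_divide)
  have "norm (q (u / of_real R)) \<le> r"
    using Schwarz_Lemma(1)[OF q_hol q0 q_lt] r by metis
  then have "norm ((k u - a) / (1 - cnj a * k u)) \<le> r"
    using R by (simp add: q_def Moebius_function_def)
  moreover have "norm (cnj a * k u) < 1"
    using norm_mult_less[of "cnj a" 1 "k u" 1] a lt1[OF u] by simp
  then have "1 - cnj a * k u \<noteq> 0"
    by auto
  ultimately have bound: "norm (k u - a) \<le> r * norm (1 - cnj a * k u)"
    by (simp add: norm_divide divide_simps)
  \<comment> \<open>Writing the denominator in terms of \<open>k u - a\<close> turns the pseudohyperbolic bound into an
      inequality for the Euclidean displacement alone.\<close>
  have "1 - cnj a * k u = of_real (1 - (norm a)\<^sup>2) - cnj a * (k u - a)"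
    using complex_norm_square[of a] by (simp add: algebra_simps)
  also have "norm \<dots> \<le> (1 - (norm a)\<^sup>2) + norm a * norm (k u - a)"
    by (rule order_trans[OF norm_triangle_ineq4])
      (use a in \<open>simp add: norm_mult abs_square_le_1 del: of_real_diff\<close>)
  also have "\<dots> \<le> (1 - (norm a)\<^sup>2) + norm (k u - a)"
    using a by (simp add: mult_left_le_one_le)
  finally have "norm (1 - cnj a * k u) \<le> (1 - (norm a)\<^sup>2) + norm (k u - a)" .
  moreover have "r \<ge> 0"
    using R by (simp add: r_def)
  ultimately have "norm (k u - a) \<le> r * ((1 - (norm a)\<^sup>2) + norm (k u - a))"
    using bound by (meson mult_left_mono order_trans)
  then have "R * norm (k u - a) \<le> R * (r * ((1 - (norm a)\<^sup>2) + norm (k u - a)))"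
    using R by (intro mult_left_mono) auto
  then show ?thesis
    using R by (simp add: r_def a_def algebra_simps)
qed

text \<open>
  The maximum principle on the disk of radius \<open>s\<close> bounds \<open>g\<close> inside by \<open>C * (1 - s\<^sup>2)\<close>,
  which tends to \<open>0\<close> as \<open>s\<close> increases to \<open>1\<close>.
\<close>

lemma holomorphic_zero_if_boundary_bound:
  fixes g :: "complex \<Rightarrow> complex"
  assumes hol: "g holomorphic_on ball 0 1"
    and bound: "\<And>\<zeta>. norm \<zeta> < 1 \<Longrightarrow> norm (g \<zeta>) \<le> C * (1 - (norm \<zeta>)\<^sup>2)"
    and \<zeta>: "norm \<zeta> < 1"
  shows "g \<zeta> = 0"
proof -
  have "norm (g \<zeta>) \<le> C * (1 - s\<^sup>2)" if s: "norm \<zeta> < s" "s < 1" for s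
  proof (rule maximum_modulus_frontier[of g "cball 0 s"])
    show "g holomorphic_on interior (cball 0 s)"
      by (rule holomorphic_on_subset[OF hol]) (use s in auto)
    show "continuous_on (closure (cball 0 s)) g"
      by (rule continuous_on_subset[OF holomorphic_on_imp_continuous_on[OF hol]]) (use s in auto)
    show "norm (g z) \<le> C * (1 - s\<^sup>2)" if "z \<in> frontier (cball 0 s)" for z
      using that bound[of z] s by (auto simp: frontier_cball)
  qed (use s in auto)
  then have "\<forall>\<^sub>F s in at_left 1. norm (g \<zeta>) \<le> C * (1 - s\<^sup>2)"
    using \<zeta> by (auto simp: eventually_at_left_field)
  moreover have "((\<lambda>s::real. C * (1 - s\<^sup>2)) \<longlongrightarrow> C * (1 - 1\<^sup>2)) (at_left 1)"
    by (intro tendsto_intros)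
  ultimately have "norm (g \<zeta>) \<le> C * (1 - 1\<^sup>2)"
    by (intro tendsto_lowerbound) auto
  then show ?thesis
    by simp
qed

text \<open>
  This is the case of one complex dimension in both variables; holomorphy in each variable
  separately suffices because the Schwarz-Pick estimate and the identity theorem are used
  for fixed \<open>\<zeta>\<close> and the maximum principle for fixed \<open>u\<close>.
\<close>

lemma disk_family_through_identity:
  fixes h :: "complex \<Rightarrow> complex \<Rightarrow> complex"
  assumes \<Omega>: "open \<Omega>" "connected \<Omega>" "0 \<in> \<Omega>"
    and hol1: "\<And>\<zeta>. norm \<zeta> < 1 \<Longrightarrow> (\<lambda>u. h u \<zeta>) holomorphic_on \<Omega>"
    and hol2: "\<And>u. u \<in> \<Omega> \<Longrightarrow> h u holomorphic_on ball 0 1"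
    and lt1: "\<And>u \<zeta>. u \<in> \<Omega> \<Longrightarrow> norm \<zeta> < 1 \<Longrightarrow> norm (h u \<zeta>) < 1"
    and id: "\<And>\<zeta>. norm \<zeta> < 1 \<Longrightarrow> h 0 \<zeta> = \<zeta>"
    and u: "u \<in> \<Omega>" and \<zeta>: "norm \<zeta> < 1"
  shows "h u \<zeta> = \<zeta>"
proof -
  obtain R where R: "R > 0" "ball 0 R \<subseteq> \<Omega>"
    using \<Omega> openE by blast
  have local: "h v \<zeta> = \<zeta>" if v: "v \<in> ball 0 R" for v
  proof -
    have "(\<lambda>z. h v z - z) holomorphic_on ball 0 1"
      using v R by (intro holomorphic_intros hol2) auto
    moreover have "norm (h v z - z) \<le> norm v / (R - norm v) * (1 - (norm z)\<^sup>2)" if z: "norm z < 1" for z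
    proof -
      have "(R - norm v) * norm (h v z - h 0 z) \<le> norm v * (1 - (norm (h 0 z))\<^sup>2)"
        by (rule Schwarz_Pick_displacement[OF holomorphic_on_subset[OF hol1]]) (use R v z lt1 in auto)
      then show ?thesis
        using v id[OF z] by (simp add: field_simps)
    qed
    ultimately have "h v \<zeta> - \<zeta> = 0"
      by (rule holomorphic_zero_if_boundary_bound[OF _ _ \<zeta>])
    then show ?thesis
      by simp
  qed
  show ?thesis
    by (rule analytic_continuation_open[of "ball 0 R" \<Omega> "\<lambda>u. h u \<zeta>" "\<lambda>_. \<zeta>"])
      (use R \<Omega> u hol1[OF \<zeta>] local in \<open>auto intro: holomorphic_intros\<close>)
qed

lemma holomorphic_map_on_comp:
  assumes f: "holomorphic_map_on sA sB f S" and g: "holomorphic_map_on sB sC g T"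
    and sub: "f ` S \<subseteq> T"
  shows "holomorphic_map_on sA sC (g \<circ> f) S"
  unfolding holomorphic_map_on_def
proof
  fix x assume x: "x \<in> S"
  obtain f' where f': "(f has_derivative f') (at x)" "Vector_Spaces.linear sA sB f'"
    using f x unfolding holomorphic_map_on_def by blast
  obtain g' where g': "(g has_derivative g') (at (f x))" "Vector_Spaces.linear sB sC g'"
    using g x sub unfolding holomorphic_map_on_def by blast
  show "\<exists>f'. (g \<circ> f has_derivative f') (at x) \<and> Vector_Spaces.linear sA sC f'"
    using diff_chain_at[OF f'(1) g'(1)] Vector_Spaces.linear_compose[OF f'(2) g'(2)] by blast
qed

text \<open>
  A Frechet derivative that is complex linear restricts on a complex line to multiplication by
  a complex number.  This is the bridge from holomorphic maps of several variables to the
  theory of one complex variable.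
\<close>

lemma holomorphic_on_complex_line:
  fixes g :: "(complex ^ 'n::finite) \<times> (complex ^ 'm::finite) \<Rightarrow> complex ^ 'k::finite"
  assumes g: "holomorphic_map_on prod_scale (*s) g S"
    and sub: "\<And>c. c \<in> T \<Longrightarrow> a + prod_scale c b \<in> S"
  shows "(\<lambda>c. g (a + prod_scale c b) $ j) holomorphic_on T"
  unfolding holomorphic_on_def
proof
  fix c assume c: "c \<in> T"
  obtain g' where g': "(g has_derivative g') (at (a + prod_scale c b))"
    and lin: "Vector_Spaces.linear prod_scale (*s) g'"
    using g sub[OF c] unfolding holomorphic_map_on_def by blast
  have vec: "bounded_linear (\<lambda>c. c *s v)" for v :: "complex ^ 'l::finite"
    by (rule linear_conv_bounded_linear[THEN iffD1])
      (auto intro!: linearI simp: vec_eq_iff algebra_simps)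
  have "bounded_linear (\<lambda>c. prod_scale c b)"
    unfolding prod_scale_def by (intro bounded_linear_Pair vec)
  then have "((\<lambda>c. a + prod_scale c b) has_derivative (\<lambda>c. prod_scale c b)) (at c)"
    by (auto intro!: derivative_eq_intros bounded_linear_imp_has_derivative)
  from diff_chain_at[OF this g']
  have "((\<lambda>c. g (a + prod_scale c b)) has_derivative (\<lambda>c. g' (prod_scale c b))) (at c)"
    by (simp add: o_def)
  then have "((\<lambda>c. g (a + prod_scale c b) $ j) has_derivative (\<lambda>c. g' (prod_scale c b) $ j)) (at c)"
    by (rule bounded_linear.has_derivative[OF bounded_linear_vec_nth])
  moreover have "(\<lambda>c. g' (prod_scale c b) $ j) = (*) (g' b $ j)"
    using module_hom.scale[OF lin[unfolded linear_iff_module_hom]] by (auto simp: mult.commute)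
  ultimately have "((\<lambda>c. g (a + prod_scale c b) $ j) has_field_derivative (g' b $ j)) (at c)"
    by (simp add: has_field_derivative_def)
  then show "(\<lambda>c. g (a + prod_scale c b) $ j) field_differentiable at c within T"
    using field_differentiable_at_within field_differentiable_def by blast
qed

lemma convex_polydisk: "convex (polydisk :: (complex ^ 'm::finite) set)"
proof -
  have "polydisk = (\<Inter>j. (\<lambda>w :: complex ^ 'm. w $ j) -` ball 0 1)"
    by (auto simp: polydisk_iff)
  moreover have "convex \<dots>"
    by (intro convex_INT convex_linear_vimage bounded_linear.linear bounded_linear_vec_nth convex_ball)
  ultimately show ?thesis
    by simp
qed

text \<open>
  Fixing all entries of \<open>w\<close> but the \<open>j\<close>-th, and observing only the \<open>j\<close>-th coordinate of the
  value, preserves the property of being the identity at \<open>z0\<close>.  Hence each coordinate is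
  governed by \<open>disk_family_through_identity\<close>.
\<close>

lemma holomorphic_family_through_identity:
  fixes g :: "(complex ^ 'n::finite) \<times> (complex ^ 'm::finite) \<Rightarrow> complex ^ 'm"
  assumes B: "open B" "convex B" "z0 \<in> B"
    and g: "holomorphic_map_on prod_scale (*s) g (B \<times> polydisk)"
    and sub: "g ` (B \<times> polydisk) \<subseteq> polydisk"
    and id: "\<And>w. w \<in> polydisk \<Longrightarrow> g (z0, w) = w"
    and z: "z \<in> B" and w: "w \<in> polydisk"
  shows "g (z, w) = w"
proof -
  have "g (z, w) $ j = w $ j" for j
  proof -
    define L where "L = (\<lambda>u. z0 + u *s (z - z0))"
    define W where "W = (\<lambda>\<zeta>. w + (\<zeta> - w $ j) *s axis j 1)"
    define \<Omega> where "\<Omega> = L -` B"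
    \<comment> \<open>\<open>W \<zeta>\<close> is \<open>w\<close> with its \<open>j\<close>-th entry replaced by \<open>\<zeta>\<close>, written as a complex line.\<close>
    have W_nth: "W \<zeta> $ i = (if i = j then \<zeta> else w $ i)" for \<zeta> i
      by (simp add: W_def axis_def)
    have W_mem: "W \<zeta> \<in> polydisk" if "norm \<zeta> < 1" for \<zeta>
      using w that by (simp add: polydisk_iff W_nth)
    have W_self: "W (w $ j) = w"
      by (simp add: W_def)
    have lin: "linear (\<lambda>u. u *s (z - z0))"
      by (auto intro!: linearI simp: vec_eq_iff algebra_simps)
    have "isCont L u" for u
      unfolding L_def using linear_continuous_at[OF linear_conv_bounded_linear[THEN iffD1, OF lin]]
      by (intro continuous_intros)
    then have "open \<Omega>"
      unfolding \<Omega>_def using B by (intro continuous_open_vimage) auto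
    \<comment> \<open>\<open>\<Omega>\<close> is convex, as the preimage of a translate of \<open>B\<close> under a linear map.\<close>
    moreover have "\<Omega> = (\<lambda>u. u *s (z - z0)) -` ((\<lambda>x. x - z0) ` B)"
      by (force simp: \<Omega>_def L_def image_iff algebra_simps)
    then have "connected \<Omega>"
      using B lin by (metis convex_connected convex_linear_vimage convex_translation_subtract)
    moreover have "0 \<in> \<Omega>"
      using B by (auto simp: \<Omega>_def L_def)
    moreover have "(\<lambda>u. g (L u, W \<zeta>) $ j) holomorphic_on \<Omega>" if "norm \<zeta> < 1" for \<zeta>
    proof -
      have eq: "(z0, W \<zeta>) + prod_scale u (z - z0, 0) = (L u, W \<zeta>)" for u
        by (simp add: prod_scale_def L_def)
      show ?thesis
        using holomorphic_on_complex_line[OF g, where T = \<Omega> and a = "(z0, W \<zeta>)" and b = "(z - z0, 0)"]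
          W_mem[OF that] by (simp add: eq \<Omega>_def)
    qed
    moreover have "(\<lambda>\<zeta>. g (L u, W \<zeta>) $ j) holomorphic_on ball 0 1" if "u \<in> \<Omega>" for u
    proof -
      have eq: "(L u, W 0) + prod_scale \<zeta> (0, axis j 1) = (L u, W \<zeta>)" for \<zeta>
        by (simp add: prod_scale_def W_def vec_eq_iff axis_def)
      show ?thesis
        using holomorphic_on_complex_line[OF g, where T = "ball 0 1" and a = "(L u, W 0)" and b = "(0, axis j 1)"]
          W_mem that by (simp add: eq \<Omega>_def)
    qed
    moreover have "norm (g (L u, W \<zeta>) $ j) < 1" if "u \<in> \<Omega>" "norm \<zeta> < 1" for u \<zeta>
      using sub W_mem[of \<zeta>] that by (auto simp: \<Omega>_def polydisk_iff image_subset_iff)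
    moreover have "g (L 0, W \<zeta>) $ j = \<zeta>" if "norm \<zeta> < 1" for \<zeta>
      using id[OF W_mem[OF that]] by (simp add: L_def W_nth)
    moreover have "1 \<in> \<Omega>"
      using z by (simp add: \<Omega>_def L_def)
    moreover have "norm (w $ j) < 1"
      using w by (simp add: polydisk_iff)
    ultimately have "g (L 1, W (w $ j)) $ j = w $ j"
      by (rule disk_family_through_identity[where h = "\<lambda>u \<zeta>. g (L u, W \<zeta>) $ j"])
    then show ?thesis
      by (simp add: W_self) (simp add: L_def)
  qed
  then show ?thesis
    by (simp add: vec_eq_iff)
qed

theorem theorem2p1:
  fixes p :: ereal
    and f :: "(complex ^ 'n::finite) \<times> (complex ^ 'm::finite) \<Rightarrow> complex ^ 'm"
    and \<phi> :: "complex ^ 'm \<Rightarrow> complex ^ 'm"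
  assumes "p \<in> {2, \<infinity>}"
    and "holomorphic_map_on prod_scale (*s) f (lp_ball p \<times> polydisk)"
    and "f ` (lp_ball p \<times> polydisk) \<subseteq> polydisk"
    and "polydisk_automorphism \<phi>"
    and "\<exists>z0 \<in> lp_ball p. \<forall>w \<in> polydisk. f (z0, w) = \<phi> w"
  shows "\<forall>z \<in> lp_ball p. \<forall>w \<in> polydisk. f (z, w) = \<phi> w"
proof (intro ballI)
  fix z :: "complex ^ 'n" and w :: "complex ^ 'm"
  assume z: "z \<in> lp_ball p" and w: "w \<in> polydisk"
  obtain z0 where z0: "z0 \<in> lp_ball p" "\<And>w. w \<in> polydisk \<Longrightarrow> f (z0, w) = \<phi> w"
    using assms(5) by blast
  define \<psi> where "\<psi> = inv_into polydisk \<phi>"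
  have bij: "bij_betw \<phi> polydisk polydisk" and \<psi>: "holomorphic_map_on (*s) (*s) \<psi> polydisk"
    using assms(4) by (auto simp: polydisk_automorphism_def biholomorphic_map_def \<psi>_def)
  have \<psi>_mem: "\<psi> y \<in> polydisk" and \<phi>_\<psi>: "\<phi> (\<psi> y) = y" if "y \<in> polydisk" for y
    using bij that by (auto simp: \<psi>_def bij_betw_def inv_into_into f_inv_into_f)
  have "lp_ball p = (ball 0 1 :: (complex ^ 'n) set) \<or> lp_ball p = (polydisk :: (complex ^ 'n) set)"
    using assms(1) lp_ball_2 lp_ball_infinity by blast
  then have ball: "open (lp_ball p :: (complex ^ 'n) set)" "convex (lp_ball p :: (complex ^ 'n) set)"
    by (auto simp: open_polydisk convex_polydisk)
  have "(\<psi> \<circ> f) (z, w) = w"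
  proof (rule holomorphic_family_through_identity[OF ball z0(1) _ _ _ z w])
    show "holomorphic_map_on prod_scale (*s) (\<psi> \<circ> f) (lp_ball p \<times> polydisk)"
      by (rule holomorphic_map_on_comp[OF assms(2) \<psi> assms(3)])
    show "(\<psi> \<circ> f) ` (lp_ball p \<times> polydisk) \<subseteq> polydisk"
      using assms(3) \<psi>_mem by auto
    show "(\<psi> \<circ> f) (z0, w) = w" if "w \<in> polydisk" for w
      using z0(2)[OF that] bij that by (simp add: \<psi>_def bij_betw_def inv_into_f_f)
  qed
  moreover have "f (z, w) \<in> polydisk"
    using assms(3) z w by blast
  ultimately show "f (z, w) = \<phi> w"
    using \<phi>_\<psi> by (metis comp_apply)
qed

end
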